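(* Let $V=\{1,\dots,d\}$, let $\Theta^\star\in\mathcal{SP}^1_d$ be a block-structured Hüsler-Reiss precision matrix with variogram matrix $\Gamma^\star$, and let $\hat\Gamma_n$, $T^\star$, the oracle weights $w^\star_{ij}$ and the sequence $(\delta_n)_n$ be as in the context. Let $(\zeta_n)_n$ be a positive sequence with $\zeta_n=o(\delta_n^{-2})$ and $\zeta_n\to\infty$ as $n\to\infty$, and let $\hat w^{(n)}_{ij}=\exp\{-\zeta_nD^2((\hat\Gamma_n)_{i\cdot},(\hat\Gamma_n)_{j\cdot})\}$. Let $\mu^\star=\min_{(i,j)\notin T^\star}D(\Gamma^\star_{i\cdot},\Gamma^\star_{j\cdot})$ (minimum over pairs $i<j$ in different clusters). Define $$a_n=\max\big(1-\exp\{-4(d-2)^2\zeta_n\delta_n^2\},\ \exp\{-\zeta_n(\mu^\star-2(d-2)\delta_n)^2\}\big),$$ which converges to $0$ as $n\to\infty$. (i) On the event $\{\|\hat\Gamma_n-\Gamma^\star\|_\infty\le\delta_n\}$, if $\mu^\star>2(d-2)\delta_n$, then $$\max_{1\le i,j\le d}|\hat w^{(n)}_{ij}-w^\star_{ij}|\le a_n.$$ (ii) Consequently, suppose (A2) and (A3) hold, $\alpha\in(0,1)$, $0<\beta<\beta'$, $n^\alpha\le k\le n/2$, $\varepsilon\ge Md^3\exp(-ck/\log(n)^8)$, and the constants $C,c,M$ in $\delta_n=\delta_n(\varepsilon)$ are those of the recalled concentration bound (CB). Then $$\max_{1\le i,j\le d}|\hat w^{(n)}_{ij}-w^\star_{ij}|=O_{\mathbb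 P}(a_n)\quad\text{as }n\to\infty.$$
   Context: **Matrices.** $\|\cdot\|_\infty$ is the entrywise maximum norm. $\mathcal{SP}^1_d$ is the set of symmetric positive semi-definite $\Theta\in\mathbb R^{d\times d}$ with $\Theta\mathbf 1_d=\mathbf 0_d$ and $\mathrm{rank}(\Theta)=d-1$. For a symmetric $d\times d$ matrix $M$ with rows $M_{i\cdot}$, $D(M_{i\cdot},M_{j\cdot})=\sqrt{\sum_{k\ne i,j}(M_{ik}-M_{jk})^2}$. **Hüsler-Reiss distribution.** A variogram matrix $\Gamma^\star$ is symmetric with zero diagonal and non-negative entries, and satisfies $a^\top\Gamma^\star a<0$ for all $a\ne0$ with $\sum_ia_i=0$. The Hüsler-Reiss (multivariate Pareto) vector $Y$ with variogram $\Gamma^\star$ has density on $\{y\in\mathbb R_+^d:\|y\|_\infty>1\}$ proportional to $y_k^{-2}\prod_{i\ne k}y_i^{-1}\phi(\tilde y_{\setminus k};\Sigma^\star_{(k)})$ (for any $k\in V$; the choice is irrelevant), where $\phi(\cdot;\Sigma)$ is the centred Gaussian density with covariance $\Sigma$, $\tilde y_{\setminus k}=(\log(y_i/y_k)+\Gamma^\star_{ik}/2)_{i\ne k}$ and $(\Sigma^\star_{(k)})_{ij}=\frac12(\Gamma^\star_{ik}+\Gamma^\star_{kj}-\Gamma^\star_{ij})$, $i,j\neq k$. Its precision matrix is $\Theta^\star=(\Pi(-\Gamma^\star/2)\Pi)^+\in\mathcal{SP}^1_d$, with $\Pi=I_d-\mathbf 1_d\mathbf 1_d^\top/d$ and $(\cdot)^+$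 the Moore-Penrose inverse. **Block structure.** $\Theta^\star$ is block-structured with respect to a partition $C_1,\dots,C_K$ of $V$ with sizes $d_1,\dots,d_K$: $\Theta^\star=\mathrm{diag}\big((a_1-r_{11})I_{d_1},\dots,(a_K-r_{KK})I_{d_K}\big)+URU^\top$, where $U\in\{0,1\}^{d\times K}$, $u_{ik}=1$ iff $i\in C_k$, $R=(r_{k\ell})$ is symmetric, and $a_k=r_{kk}-\sum_\ell d_\ell r_{k\ell}$. Equivalently $\Gamma^\star$ has the same block structure: entries depend only on the clusters of the indices, off the diagonal. $T^\star=\{(i,j)\in V^2,i<j:D(\Theta^\star_{i\cdot},\Theta^\star_{j\cdot})=0\}$ is the set of pairs in the same cluster. Oracle weights: $w^\star_{ij}=1$ if $i,j$ belong to the same cluster, $0$ otherwise. **Data.** $X$ is a random vector in $\mathbb R^d$ with marginal distribution functions $F_1,\dots,F_d$ (empirical versions $\hat F_i$ based on $n$ i.i.d. copies of $X$), in the domain of attraction of $Y$: after standardising the margins to the standard Pareto scale, $\mathbb P(X/u\le z\mid\|X\|_\infty>u)\to\mathbb P(Y\le z)$ as $u\to\infty$. With $k=k_n$ the number of retained extremes, the empirical variogram is $\hat\Gamma_n=\frac1d\sum_{m\in V}\hat\Gamma^{(m)}_n$, where $(\hat\Gamma_n^{(m)})_{ij}$ is the sample variance of $\log(\frac n{n+1}-\hat F_i(X_i))-\log(\frac n{n+1}-\hat F_j(X_j))$ over the observations with $\hat F_m(X_m)>1-\frac kn$ (with $\hat F_i$ normalised so that the logarithms are defined). **Sequence $\delta_n$.**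 For positive constants $C,c,M,\beta$ and a fixed level $\varepsilon$, $$\delta_n=\delta_n(\varepsilon)=C\Big\{\big(\tfrac kn\big)^\beta\log\big(\tfrac nk\big)^2+\frac{1+\sqrt{\frac1c\log(Md^3/\varepsilon)}}{\sqrt k}\Big\}.$$ **Assumptions.** (A2) $F_1,\dots,F_d$ are continuous and there are $\tilde K,\beta'>0$ such that for all $J\subset V$ with $|J|\in\{2,3\}$ and $q\in(0,1]$, $$\sup_{x\in[0,1]^{|J|}}\Big|\tfrac1q\mathbb P(F_J(X_J)>\mathbf 1-qx_J)-\frac{\mathbb P(Y_J>1/x_J)}{\mathbb P(Y_1>1)}\Big|\le\tilde Kq^{\beta'}$$ (inequalities and operations componentwise). (A3) The (off-diagonal) entries of $\Gamma^\star$ are finite and strictly positive. **Recalled concentration bound (CB)** (known result): under (A2), (A3), for any $\alpha\in(0,1)$ and $\beta<\beta'$ there are constants $C,c,M$ depending only on $\alpha,\tilde K,\beta$ such that for any $n^\alpha\le k\le n/2$ and $\varepsilon\ge Md^3\exp(-ck/\log(n)^8)$, $\mathbb P(\|\hat\Gamma_n-\Gamma^\star\|_\infty>\delta_n(\varepsilon))\le\varepsilon$. *)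

theory Defs
  imports "HOL-Probability.Probability" "HOL-Library.Landau_Symbols"
begin

text \<open>The index set \<open>V = {1,\<dots>,d}\<close> is the universe of a finite linearly ordered type \<open>'d\<close>, so
  \<open>d = CARD('d)\<close>. Clusters are indexed by a finite type \<open>'k\<close>, so \<open>K = CARD('k)\<close>. The entrywise
  maximum norm of vectors and matrices is \<^const>\<open>infnorm\<close>.\<close>

type_synonym 'd rvec = "real^'d"
type_synonym 'd rmat = "real^'d^'d"

section \<open>Matrices\<close>

definition ones :: "'d::finite rvec" where
  "ones = (\<chi> i. 1)"

definition SP1 :: "('d::finite rmat) set" where
  "SP1 = {\<Theta>. transpose \<Theta> = \<Theta> \<and> (\<forall>x. 0 \<le> x \<bullet> (\<Theta> *v x)) \<and> \<Theta> *v ones = 0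
              \<and> rank \<Theta> = CARD('d) - 1}"

definition D :: "'d::finite rmat \<Rightarrow> 'd \<Rightarrow> 'd \<Rightarrow> real" where
  "D M i j = sqrt (\<Sum>k\<in>UNIV - {i, j}. (M$i$k - M$j$k)\<^sup>2)"

definition variogram :: "'d::finite rmat \<Rightarrow> bool" where
  "variogram \<Gamma> \<longleftrightarrow> transpose \<Gamma> = \<Gamma> \<and> (\<forall>i. \<Gamma>$i$i = 0) \<and> (\<forall>i j. 0 \<le> \<Gamma>$i$j)
     \<and> (\<forall>a. a \<noteq> 0 \<longrightarrow> (\<Sum>i\<in>UNIV. a$i) = 0 \<longrightarrow> a \<bullet> (\<Gamma> *v a) < 0)"

definition moore_penrose_inverse :: "'d::finite rmat \<Rightarrow> 'd rmat \<Rightarrow> bool" where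
  "moore_penrose_inverse A B \<longleftrightarrow> A ** B ** A = A \<and> B ** A ** B = B
     \<and> transpose (A ** B) = A ** B \<and> transpose (B ** A) = B ** A"

definition centering :: "'d::finite rmat" where
  "centering = mat 1 - (\<chi> i j. 1 / real CARD('d))"

definition hr_precision_matrix :: "'d::finite rmat \<Rightarrow> 'd rmat \<Rightarrow> bool" where
  "hr_precision_matrix \<Gamma> \<Theta> \<longleftrightarrow>
     moore_penrose_inverse (centering ** ((- 1 / 2) *\<^sub>R \<Gamma>) ** centering) \<Theta>"

section \<open>Block structure\<close>

definition is_clustering :: "('k::finite \<Rightarrow> 'd::finite set) \<Rightarrow> bool" where
  "is_clustering Cl \<longleftrightarrow> partition_on UNIV (range Cl) \<and> inj Cl"

definition same_cluster :: "('k \<Rightarrow> 'd::finite set) \<Rightarrow> 'd \<Rightarrow> 'd \<Rightarrow> bool" where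
  "same_cluster Cl i j \<longleftrightarrow> (\<exists>k. i \<in> Cl k \<and> j \<in> Cl k)"

definition membership :: "('k::finite \<Rightarrow> 'd::finite set) \<Rightarrow> real^'k^'d" where
  "membership Cl = (\<chi> i k. if i \<in> Cl k then 1 else 0)"

definition block_diag :: "('k::finite \<Rightarrow> 'd::finite set) \<Rightarrow> ('k \<Rightarrow> real) \<Rightarrow> 'd rmat" where
  "block_diag Cl v = (\<chi> i j. if i = j then (\<Sum>k | i \<in> Cl k. v k) else 0)"

definition block_structured :: "('k::finite \<Rightarrow> 'd::finite set) \<Rightarrow> 'd rmat \<Rightarrow> bool" where
  "block_structured Cl \<Theta> \<longleftrightarrow>
     (\<exists>(R :: 'k rmat) a.
        transpose R = R
        \<and> (\<forall>k. a k = R$k$k - (\<Sum>l\<in>UNIV. real (card (Cl l)) * R$k$l))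
        \<and> \<Theta> = block_diag Cl (\<lambda>k. a k - R$k$k)
              + membership Cl ** R ** transpose (membership Cl))"

definition T_star :: "'d::{finite,linorder} rmat \<Rightarrow> ('d \<times> 'd) set" where
  "T_star \<Theta> = {(i, j). i < j \<and> D \<Theta> i j = 0}"

definition w_star :: "('k \<Rightarrow> 'd::finite set) \<Rightarrow> 'd \<Rightarrow> 'd \<Rightarrow> real" where
  "w_star Cl i j = (if same_cluster Cl i j then 1 else 0)"

text \<open>Extended-real valued, so that the minimum over the empty set (a single cluster) is \<open>\<infinity>\<close>.\<close>

definition mu_star :: "'d::{finite,linorder} rmat \<Rightarrow> 'd rmat \<Rightarrow> ereal" where
  "mu_star \<Gamma> \<Theta> =
     (INF (i, j) \<in> {(i, j). i < j \<and> (i, j) \<notin> T_star \<Theta>}. ereal (D \<Gamma> i j))"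

section \<open>The Huesler--Reiss multivariate Pareto distribution\<close>

definition Sigma_k :: "'d::finite rmat \<Rightarrow> 'd \<Rightarrow> 'd rmat" where
  "Sigma_k \<Gamma> k = (\<chi> i j. (\<Gamma>$i$k + \<Gamma>$k$j - \<Gamma>$i$j) / 2)"

text \<open>Centred Gaussian density on the coordinates \<open>V - {k}\<close>, with covariance the submatrix of
  \<open>\<Sigma>\<close> on these coordinates. To stay within one vector type, row and column \<open>k\<close> of \<open>\<Sigma>\<close>
  are replaced by those of the identity, which preserves the determinant and the inverse of the
  submatrix, and coordinate \<open>k\<close> of the argument is set to \<open>0\<close>.\<close>

definition pad :: "'d::finite \<Rightarrow> 'd rmat \<Rightarrow> 'd rmat" where
  "pad k \<Sigma> = (\<chi> i j. if i = k \<or> j = k then (if i = j then 1 else 0) else \<Sigma>$i$j)"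

definition gauss_density :: "'d::finite \<Rightarrow> 'd rmat \<Rightarrow> 'd rvec \<Rightarrow> real" where
  "gauss_density k \<Sigma> x =
     (let z = (\<chi> i. if i = k then 0 else x$i) in
      exp (- (z \<bullet> (matrix_inv (pad k \<Sigma>) *v z)) / 2)
      / sqrt ((2 * pi) ^ (CARD('d) - 1) * det (pad k \<Sigma>)))"

definition hr_kernel :: "'d::finite rmat \<Rightarrow> 'd \<Rightarrow> 'd rvec \<Rightarrow> real" where
  "hr_kernel \<Gamma> k y =
     (if (\<forall>i. 0 < y$i) \<and> infnorm y > 1
      then 1 / (y$k)\<^sup>2 * (\<Prod>i\<in>UNIV - {k}. 1 / y$i)
           * gauss_density k (Sigma_k \<Gamma> k) (\<chi> i. ln (y$i / y$k) + \<Gamma>$i$k / 2)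
      else 0)"

definition husler_reiss :: "'b measure \<Rightarrow> ('b \<Rightarrow> 'd::finite rvec) \<Rightarrow> 'd rmat \<Rightarrow> bool" where
  "husler_reiss Q Y \<Gamma> \<longleftrightarrow>
     (\<forall>k. \<exists>c>0. distributed Q lborel Y (\<lambda>y. ennreal (c * hr_kernel \<Gamma> k y)))"

section \<open>Data and empirical variogram\<close>

definition marg_cdf :: "'a measure \<Rightarrow> ('a \<Rightarrow> 'd::finite rvec) \<Rightarrow> 'd \<Rightarrow> real \<Rightarrow> real" where
  "marg_cdf P X i = cdf (distr P borel (\<lambda>\<omega>. X \<omega> $ i))"

definition pareto_scale :: "'a measure \<Rightarrow> ('a \<Rightarrow> 'd::finite rvec) \<Rightarrow> 'a \<Rightarrow> 'd rvec" where
  "pareto_scale P X \<omega> = (\<chi> i. 1 / (1 - marg_cdf P X i (X \<omega> $ i)))"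

definition in_domain_of_attraction ::
    "'a measure \<Rightarrow> ('a \<Rightarrow> 'd::finite rvec) \<Rightarrow> 'b measure \<Rightarrow> ('b \<Rightarrow> 'd rvec) \<Rightarrow> bool" where
  "in_domain_of_attraction P X Q Y \<longleftrightarrow>
     (\<forall>z :: 'd rvec.
        ((\<lambda>u::real. \<P>(\<omega> in P. (\<forall>i. pareto_scale P X \<omega> $ i / u \<le> z$i)
                      \<bar> infnorm (pareto_scale P X \<omega>) > u))
          \<longlongrightarrow> \<P>(\<omega> in Q. \<forall>i. Y \<omega> $ i \<le> z$i)) at_top)"

definition iid_copies :: "'a measure \<Rightarrow> ('a \<Rightarrow> 'd::finite rvec) \<Rightarrow> (nat \<Rightarrow> 'a \<Rightarrow> 'd rvec) \<Rightarrow> bool" where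
  "iid_copies P X Xs \<longleftrightarrow>
     X \<in> borel_measurable P
     \<and> prob_space.indep_vars P (\<lambda>_. borel) Xs UNIV
     \<and> (\<forall>t. distr P borel (Xs t) = distr P borel X)"

text \<open>In the following, \<open>x t\<close> for \<open>t < n\<close> are the \<open>n\<close> observations. The empirical distribution
  function is left-continuous and normalised by \<open>n + 1\<close>: at the observation of rank \<open>r\<close>
  it equals \<open>(r - 1) / (n + 1)\<close>, so that \<open>n / (n + 1)\<close> minus it is positive.\<close>

definition emp_cdf :: "nat \<Rightarrow> (nat \<Rightarrow> 'd::finite rvec) \<Rightarrow> 'd \<Rightarrow> real \<Rightarrow> real" where
  "emp_cdf n x i v = real (card {t. t < n \<and> x t $ i < v}) / (real n + 1)"

definition log_excess :: "nat \<Rightarrow> (nat \<Rightarrow> 'd::finite rvec) \<Rightarrow> 'd \<Rightarrow> nat \<Rightarrow> real" where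
  "log_excess n x i t = ln (real n / (real n + 1) - emp_cdf n x i (x t $ i))"

definition exceedances :: "nat \<Rightarrow> nat \<Rightarrow> (nat \<Rightarrow> 'd::finite rvec) \<Rightarrow> 'd \<Rightarrow> nat set" where
  "exceedances n k x m = {t. t < n \<and> emp_cdf n x m (x t $ m) > 1 - real k / real n}"

definition sample_variance :: "nat set \<Rightarrow> (nat \<Rightarrow> real) \<Rightarrow> real" where
  "sample_variance S v =
     (\<Sum>t\<in>S. (v t - (\<Sum>s\<in>S. v s) / real (card S))\<^sup>2) / (real (card S) - 1)"

definition emp_variogram_m :: "nat \<Rightarrow> nat \<Rightarrow> (nat \<Rightarrow> 'd::finite rvec) \<Rightarrow> 'd \<Rightarrow> 'd rmat" where
  "emp_variogram_m n k x m =
     (\<chi> i j. sample_variance (exceedances n k x m) (\<lambda>t. log_excess n x i t - log_excess n x j t))"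

definition emp_variogram :: "nat \<Rightarrow> nat \<Rightarrow> (nat \<Rightarrow> 'd::finite rvec) \<Rightarrow> 'd rmat" where
  "emp_variogram n k x = (1 / real CARD('d)) *\<^sub>R (\<Sum>m\<in>UNIV. emp_variogram_m n k x m)"

definition w_hat :: "real \<Rightarrow> 'd::finite rmat \<Rightarrow> 'd \<Rightarrow> 'd \<Rightarrow> real" where
  "w_hat \<zeta> G i j = exp (- \<zeta> * (D G i j)\<^sup>2)"

definition weight_error :: "('k \<Rightarrow> 'd::finite set) \<Rightarrow> real \<Rightarrow> 'd rmat \<Rightarrow> real" where
  "weight_error Cl \<zeta> G = (MAX (i, j)\<in>UNIV. \<bar>w_hat \<zeta> G i j - w_star Cl i j\<bar>)"

section \<open>Rates\<close>

definition delta ::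
    "real \<Rightarrow> real \<Rightarrow> real \<Rightarrow> real \<Rightarrow> nat \<Rightarrow> nat \<Rightarrow> nat \<Rightarrow> real \<Rightarrow> real" where
  "delta C c M \<beta> d n k \<epsilon> =
     C * ((real k / real n) powr \<beta> * (ln (real n / real k))\<^sup>2
          + (1 + sqrt (1 / c * ln (M * real d ^ 3 / \<epsilon>))) / sqrt (real k))"

text \<open>For \<open>\<mu> = \<infinity>\<close> the second exponential is read as \<open>exp (- \<infinity>) = 0\<close>.\<close>

definition a_rate :: "nat \<Rightarrow> ereal \<Rightarrow> real \<Rightarrow> real \<Rightarrow> real" where
  "a_rate d \<mu> \<zeta> \<delta> =
     max (1 - exp (- 4 * (real d - 2)\<^sup>2 * \<zeta> * \<delta>\<^sup>2))
         (if \<mu> = \<infinity> then 0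
          else exp (- \<zeta> * (real_of_ereal \<mu> - 2 * (real d - 2) * \<delta>)\<^sup>2))"

definition bigO_in_prob :: "'a measure \<Rightarrow> (nat \<Rightarrow> 'a \<Rightarrow> real) \<Rightarrow> (nat \<Rightarrow> real) \<Rightarrow> bool" where
  "bigO_in_prob P Z a \<longleftrightarrow>
     (\<forall>\<eta>>0. \<exists>B>0. \<forall>\<^sub>F n in sequentially. \<P>(\<omega> in P. \<bar>Z n \<omega>\<bar> > B * \<bar>a n\<bar>) \<le> \<eta>)"

section \<open>Assumptions and the concentration bound\<close>

text \<open>The division by \<open>x$i\<close> is taken in the extended reals, where \<open>1 / 0 = \<infinity>\<close>.\<close>

definition assumption_A2 ::
    "'a measure \<Rightarrow> ('a \<Rightarrow> 'd rvec) \<Rightarrow> 'b measure \<Rightarrow> ('b \<Rightarrow> 'd::{finite,linorder} rvec)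
      \<Rightarrow> real \<Rightarrow> real \<Rightarrow> bool" where
  "assumption_A2 P X Q Y K \<beta>' \<longleftrightarrow>
     (\<forall>i. continuous_on UNIV (marg_cdf P X i)) \<and> K > 0 \<and> \<beta>' > 0
     \<and> (\<forall>J::'d set. card J \<in> {2, 3} \<longrightarrow>
          (\<forall>q\<in>{0<..1}. \<forall>x::'d rvec. (\<forall>i\<in>J. x$i \<in> {0..1}) \<longrightarrow>
             \<bar>1 / q * \<P>(\<omega> in P. \<forall>i\<in>J. marg_cdf P X i (X \<omega> $ i) > 1 - q * x$i)
               - \<P>(\<omega> in Q. \<forall>i\<in>J. ereal (Y \<omega> $ i) > 1 / ereal (x$i))
                 / \<P>(\<omega> in Q. Y \<omega> $ Min UNIV > 1)\<bar> \<le> K * q powr \<beta>'))"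

definition assumption_A3 :: "'d::finite rmat \<Rightarrow> bool" where
  "assumption_A3 \<Gamma> \<longleftrightarrow> (\<forall>i j. i \<noteq> j \<longrightarrow> 0 < \<Gamma>$i$j)"

text \<open>\<open>C\<close>, \<open>c\<close>, \<open>M\<close> are valid constants in the concentration bound for the empirical
  variogram. The condition \<open>\<epsilon> \<le> M d\<^sup>3\<close> says that the square root in \<^const>\<open>delta\<close>
  has a non-negative argument.\<close>

definition concentration_bound ::
    "'a measure \<Rightarrow> ('a \<Rightarrow> 'd rvec) \<Rightarrow> (nat \<Rightarrow> 'a \<Rightarrow> 'd rvec)
      \<Rightarrow> 'b measure \<Rightarrow> ('b \<Rightarrow> 'd::{finite,linorder} rvec) \<Rightarrow> 'd rmat
      \<Rightarrow> real \<Rightarrow> real \<Rightarrow> real \<Rightarrow> real \<Rightarrow> real \<Rightarrow> real \<Rightarrow> real \<Rightarrow> bool" where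
  "concentration_bound P X Xs Q Y \<Gamma> K \<beta>' \<alpha> \<beta> C c M \<longleftrightarrow>
     (assumption_A2 P X Q Y K \<beta>' \<and> assumption_A3 \<Gamma> \<longrightarrow>
        (\<forall>(n::nat) (k::nat) \<epsilon>.
           0 < n \<and> real n powr \<alpha> \<le> real k \<and> real k \<le> real n / 2
           \<and> M * real CARD('d) ^ 3 * exp (- c * real k / ln (real n) ^ 8) \<le> \<epsilon>
           \<and> \<epsilon> \<le> M * real CARD('d) ^ 3 \<longrightarrow>
           \<P>(\<omega> in P. infnorm (emp_variogram n k (\<lambda>t. Xs t \<omega>) - \<Gamma>)
                      > delta C c M \<beta> CARD('d) n k \<epsilon>) \<le> \<epsilon>))"

end

theory Submission
  imports Defs "HOL-Combinatorics.Transposition" "HOL-Real_Asymp.Real_Asymp"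
begin

text \<open>Both block structures are invariance under exchanging two indices. The Moore-Penrose inverse is
  unique, hence inherits this invariance, and \<open>\<Gamma>\<close> is recovered from
  \<open>A = \<Pi>(- \<Gamma>/2)\<Pi>\<close> through \<open>\<Gamma>\<^sub>i\<^sub>j = A\<^sub>i\<^sub>i + A\<^sub>j\<^sub>j - 2A\<^sub>i\<^sub>j\<close>; so the row distances of
  \<open>\<Theta>\<close> and \<open>\<Gamma>\<close> vanish for the same pairs. Part (i) is then the Lipschitz bound
  \<open>2(d - 2)\<delta>\<close> for a row distance under an entrywise perturbation of size \<open>\<delta>\<close>.

  The concentration bound at the fixed level \<open>\<epsilon>\<close> only gives probability \<open>\<epsilon>\<close>. For boundedness in
  probability it is applied at every level \<open>\<epsilon>' \<le> \<epsilon>\<close>: the radius \<open>\<delta>\<^sub>n(\<epsilon>')\<close> is at most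
  a constant multiple \<open>L\<delta>\<^sub>n(\<epsilon>)\<close>, and replacing \<open>\<delta>\<^sub>n\<close> by \<open>L\<delta>\<^sub>n\<close> eventually changes the
  rate \<open>a\<^sub>n\<close> by a bounded factor only.\<close>

section \<open>Moore-Penrose inverse: uniqueness and invariance under index swaps\<close>

text \<open>\<open>A ** B\<close> and \<open>A ** B'\<close> are both the orthogonal projection onto
  the range of \<open>A\<close>; likewise \<open>B ** A\<close> and \<open>B' ** A\<close> are one
  projection. Hence \<open>B = B ** A ** B = B' ** A ** B = B' ** A ** B' = B'\<close>.\<close>

lemma moore_penrose_inverse_unique:
  assumes "moore_penrose_inverse A B" "moore_penrose_inverse A B'"
  shows "B = B'"
proof -
  have B: "A ** B ** A = A" "B ** A ** B = B" "transpose (A ** B) = A ** B" "transpose (B ** A) = B ** A"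
    and B': "A ** B' ** A = A" "B' ** A ** B' = B'" "transpose (A ** B') = A ** B'" "transpose (B' ** A) = B' ** A"
    using assms by (simp_all add: moore_penrose_inverse_def)
  have AB: "A ** B = A ** B'"
  proof -
    have "A ** B = transpose ((A ** B') ** (A ** B))"
      by (simp add: matrix_mul_assoc B'(1) B(3))
    also have "\<dots> = (A ** B) ** (A ** B')"
      by (simp only: matrix_transpose_mul[of "A ** B'"] B(3) B'(3))
    finally show ?thesis by (simp add: matrix_mul_assoc B(1))
  qed
  have BA: "B ** A = B' ** A"
  proof -
    have "B ** A = transpose (B ** (A ** B' ** A))"
      by (simp only: B'(1) B(4))
    also have "\<dots> = transpose ((B ** A) ** (B' ** A))"
      by (simp only: matrix_mul_assoc)
    also have "\<dots> = (B' ** A) ** (B ** A)"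
      by (simp only: matrix_transpose_mul[of "B ** A"] B(4) B'(4))
    also have "\<dots> = B' ** (A ** B ** A)"
      by (simp only: matrix_mul_assoc)
    finally show ?thesis by (simp only: B(1))
  qed
  have "B = B' ** A ** B"
    by (simp only: B(2) flip: BA)
  also have "\<dots> = B' ** (A ** B')"
    by (simp only: AB flip: matrix_mul_assoc)
  also have "\<dots> = B'"
    by (simp only: matrix_mul_assoc B'(2))
  finally show ?thesis .
qed

text \<open>Symmetric and its own inverse, so \<open>S ** M ** S\<close> is conjugation by the
  permutation; for \<open>i = j\<close> it is the identity.\<close>

definition swap_matrix :: "'d::finite \<Rightarrow> 'd \<Rightarrow> 'd rmat" where
  "swap_matrix i j = (\<chi> p q. if q = Transposition.transpose i j p then 1 else 0)"

lemma swap_matrix_conj: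
  "(swap_matrix i j ** M ** swap_matrix i j) $ p $ q
     = M $ (Transposition.transpose i j p) $ (Transposition.transpose i j q)"
proof -
  have eq: "(q = Transposition.transpose i j r) = (r = Transposition.transpose i j q)" for q r
    by (metis transpose_involutory)
  show ?thesis
    by (simp add: swap_matrix_def matrix_matrix_mult_def if_distrib[of "\<lambda>x. x * _"] 
        if_distrib[of "\<lambda>x. _ * x"] eq[of q] cong: if_cong)
qed

lemma transpose_swap_matrix: "transpose (swap_matrix i j) = swap_matrix i j"
  by (auto simp: swap_matrix_def transpose_def vec_eq_iff)

lemma swap_matrix_involutory: "swap_matrix i j ** swap_matrix i j = mat 1"
proof -
  have "(swap_matrix i j ** mat 1 ** swap_matrix i j) $ p $ q = (mat 1 :: 'a rmat) $ p $ q" for p q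
    unfolding swap_matrix_conj by (simp add: mat_def inj_eq)
  thus ?thesis by (simp add: vec_eq_iff)
qed

text \<open>Conjugation by an orthogonal matrix turns a Moore-Penrose inverse of \<open>A\<close>
  into one of the conjugate of \<open>A\<close>, which here is \<open>A\<close> itself; uniqueness
  then fixes \<open>B\<close>.\<close>

lemma moore_penrose_inverse_swap:
  assumes "moore_penrose_inverse A B" and inv: "swap_matrix i j ** A ** swap_matrix i j = A"
  shows "swap_matrix i j ** B ** swap_matrix i j = B"
proof (rule moore_penrose_inverse_unique)
  define S :: "'a rmat" where "S = swap_matrix i j"
  have SS: "S ** S = mat 1" and ST: "transpose S = S"
    by (simp_all add: S_def swap_matrix_involutory transpose_swap_matrix)
  have SS': "N ** S ** S = N" for N :: "'a rmat"
    by (metis SS matrix_mul_assoc matrix_mul_rid)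
  have conj: "(S ** M ** S) ** (S ** N ** S) = S ** (M ** N) ** S" for M N
    by (simp add: matrix_mul_assoc SS')
  have tr: "transpose (S ** M ** S) = S ** transpose M ** S" for M
    by (simp add: matrix_transpose_mul ST matrix_mul_assoc)
  \<comment> \<open>All eight occurrences of \<open>A\<close> in the Penrose equations are replaced
    by its conjugate; each equation is then the conjugate of one that \<open>B\<close>
    satisfies.\<close>
  show "moore_penrose_inverse A (swap_matrix i j ** B ** swap_matrix i j)"
    using assms(1) conj tr unfolding moore_penrose_inverse_def 
    by (subst (1 2 3 4 5 6 7 8) inv[symmetric], fold S_def) simp
qed fact

lemma moore_penrose_inverse_sym:
  "moore_penrose_inverse A B \<longleftrightarrow> moore_penrose_inverse B A"
  by (auto simp: moore_penrose_inverse_def)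

text \<open>Double centring: \<open>centering\<close> on the left subtracts column means, on the
  right row means.\<close>

lemma centering_conj:
  fixes M :: "'d::finite rmat"
  shows "(centering ** M ** centering) $ p $ q =
    M $ p $ q - (\<Sum>r\<in>UNIV. M $ r $ q) / real CARD('d) - (\<Sum>s\<in>UNIV. M $ p $ s) / real CARD('d)
      + (\<Sum>r\<in>UNIV. \<Sum>s\<in>UNIV. M $ r $ s) / (real CARD('d))\<^sup>2"
proof -
  have L: "(centering ** N) $ p $ q = N $ p $ q - (\<Sum>r\<in>UNIV. N $ r $ q) / real CARD('d)"
    for N :: "'d rmat" and p q
    by (simp add: centering_def matrix_matrix_mult_def mat_def left_diff_distrib sum_subtractf
        if_distrib[of "\<lambda>x. x * _"] sum_divide_distrib cong: if_cong)
  have R: "(N ** centering) $ p $ q = N $ p $ q - (\<Sum>r\<in>UNIV. N $ p $ r) / real CARD('d)"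
    for N :: "'d rmat" and p q
    by (simp add: centering_def matrix_matrix_mult_def mat_def right_diff_distrib sum_subtractf
        if_distrib[of "\<lambda>x. _ * x"] sum_divide_distrib cong: if_cong)
  have "(\<Sum>s\<in>UNIV. (centering ** M) $ p $ s)
      = (\<Sum>s\<in>UNIV. M $ p $ s - (\<Sum>r\<in>UNIV. M $ r $ s) / real CARD('d))"
    by (intro sum.cong refl L)
  also have "\<dots> = (\<Sum>s\<in>UNIV. M $ p $ s) - (\<Sum>r\<in>UNIV. \<Sum>s\<in>UNIV. M $ r $ s) / real CARD('d)"
    by (subst sum.swap) (simp add: sum_subtractf sum_divide_distrib)
  finally show ?thesis
    by (simp add: R L diff_divide_distrib power2_eq_square)
qed

section \<open>Row distances and swap invariance\<close>

lemma D_eq_0_iff: "D M i j = 0 \<longleftrightarrow> (\<forall>k. k \<noteq> i \<longrightarrow> k \<noteq> j \<longrightarrow> M $ i $ k = M $ j $ k)"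
  by (auto simp: D_def sum_nonneg_eq_0_iff)

lemma D_sym: "D M i j = D M j i"
  unfolding D_def
  by (subst insert_commute) (intro arg_cong[where f = sqrt] sum.cong refl power2_commute)

lemma D_refl: "D M i i = 0"
  by (simp add: D_eq_0_iff)

lemma D_nonneg: "0 \<le> D M i j"
  by (simp add: D_def sum_nonneg)

text \<open>\<open>D\<close> ignores the columns \<open>i\<close> and \<open>j\<close>. What it
  leaves open is the block on \<open>{i, j}\<close>, where symmetry settles the off-diagonal entries
  and the second hypothesis the diagonal ones.\<close>

lemma swap_invariantI:
  fixes M :: "'d::finite rmat"
  assumes "transpose M = M" "M $ i $ i = M $ j $ j" "D M i j = 0"
  shows "swap_matrix i j ** M ** swap_matrix i j = M"
proof -
  have sym: "M $ p $ q = M $ q $ p" for p q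
    using assms(1) by (metis transpose_def vec_lambda_beta)
  have row: "M $ i $ k = M $ j $ k" if "k \<noteq> i" "k \<noteq> j" for k
    using assms(3) that by (simp add: D_eq_0_iff)
  have col: "M $ k $ i = M $ k $ j" if "k \<noteq> i" "k \<noteq> j" for k
    using row[OF that] by (simp only: sym[of k])
  have "M $ (Transposition.transpose i j p) $ (Transposition.transpose i j q) = M $ p $ q" for p q
  proof -
    consider "p \<in> {i, j}" "q \<in> {i, j}" | "p \<in> {i, j}" "q \<notin> {i, j}"
      | "p \<notin> {i, j}" "q \<in> {i, j}" | "p \<notin> {i, j}" "q \<notin> {i, j}"
      by blast
    thus ?thesis
    proof cases
      case 1
      then show ?thesis using assms(2) sym[of j i] by (elim insertE emptyE) simp_all
    next
      case 2
      then show ?thesis using row[of q] by (elim insertE emptyE) simp_all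
    next
      case 3
      then show ?thesis using col[of p] by (elim insertE emptyE) simp_all
    qed simp
  qed
  thus ?thesis
    by (simp add: vec_eq_iff swap_matrix_conj)
qed

lemma swap_invariantD:
  assumes "swap_matrix i j ** M ** swap_matrix i j = M"
  shows "D M i j = 0" "M $ i $ i = M $ j $ j"
proof -
  have *: "M $ p $ q = M $ (Transposition.transpose i j p) $ (Transposition.transpose i j q)" for p q
    by (metis assms swap_matrix_conj)
  show "D M i j = 0"
    unfolding D_eq_0_iff using *[of i] by (simp add: Transposition.transpose_def)
  show "M $ i $ i = M $ j $ j"
    using *[of i i] by simp
qed

text \<open>Swap invariance passes between \<open>A\<close> and \<open>\<Theta>\<close>. The
  equality of diagonal entries that it requires comes from row sums: for \<open>A\<close> from equal
  row sums of \<Gamma>, for \<Theta> from its vanishing row sums.\<close>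

lemma hr_precision_D_eq_0_iff:
  fixes \<Gamma> \<Theta> :: "'d::finite rmat"
  assumes "variogram \<Gamma>" "hr_precision_matrix \<Gamma> \<Theta>" "\<Theta> \<in> SP1"
  shows "D \<Theta> i j = 0 \<longleftrightarrow> D \<Gamma> i j = 0"
proof -
  define A where "A = centering ** ((- 1 / 2) *\<^sub>R \<Gamma>) ** (centering :: 'd rmat)"
  have mp: "moore_penrose_inverse A \<Theta>"
    using assms(2) by (simp add: hr_precision_matrix_def A_def)
  have G: "transpose \<Gamma> = \<Gamma>" "\<Gamma> $ p $ p = 0" for p
    using assms(1) by (auto simp: variogram_def)
  have Gsym: "\<Gamma> $ p $ q = \<Gamma> $ q $ p" for p q
    using G(1) by (metis transpose_def vec_lambda_beta)
  \<comment> \<open>Row means and overall mean of \<Gamma>. As the diagonal of \<Gamma> vanishes,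
    \<open>A $ p $ p\<close> is \<open>r p - m / 2\<close>.\<close>
  define r where "r p = (\<Sum>s\<in>UNIV. \<Gamma> $ p $ s) / real CARD('d)" for p
  define m where "m = (\<Sum>p\<in>UNIV. \<Sum>s\<in>UNIV. \<Gamma> $ p $ s) / (real CARD('d))\<^sup>2"
  have r': "(\<Sum>s\<in>UNIV. \<Gamma> $ s $ p) / real CARD('d) = r p" for p
    using Gsym by (simp add: r_def)
  have A: "A $ p $ q = (r p + r q - m - \<Gamma> $ p $ q) / 2" for p q
    unfolding A_def centering_conj r'[symmetric]
    using Gsym[of p] 
    by (simp add: m_def field_simps sum_negf flip: sum_divide_distrib)
  show ?thesis
  proof
    assume D: "D \<Gamma> i j = 0"
    have row: "\<Gamma> $ i $ k = \<Gamma> $ j $ k" if "k \<noteq> i" "k \<noteq> j" for k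
      using D that by (simp add: D_eq_0_iff)
    \<comment> \<open>Row \<open>i\<close> is row \<open>j\<close> with the entries at
      \<open>i\<close> and \<open>j\<close> exchanged, because the diagonal is zero and \<Gamma> is
      symmetric.\<close>
    have "(\<Sum>s\<in>UNIV. \<Gamma> $ i $ s) = (\<Sum>s\<in>UNIV. \<Gamma> $ j $ (Transposition.transpose i j s))"
      using row G(2) Gsym[of i j] by (intro sum.cong) (auto simp: Transposition.transpose_def)
    also have "\<dots> = (\<Sum>s\<in>UNIV. \<Gamma> $ j $ s)"
      by (rule sum.reindex_bij_betw) simp
    finally have "r i = r j" by (simp add: r_def)
    hence "swap_matrix i j ** A ** swap_matrix i j = A"
      using Gsym G(2) row by (intro swap_invariantI) (auto simp: transpose_def vec_eq_iff D_eq_0_iff A)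
    thus "D \<Theta> i j = 0"
      using moore_penrose_inverse_swap[OF mp] swap_invariantD(1) by blast
  next
    assume D: "D \<Theta> i j = 0"
    have T: "transpose \<Theta> = \<Theta>" "\<Theta> *v ones = 0"
      using assms(3) by (auto simp: SP1_def)
    have Tsym: "\<Theta> $ p $ q = \<Theta> $ q $ p" for p q
      using T(1) by (metis transpose_def vec_lambda_beta)
    have Tsum: "(\<Sum>q\<in>UNIV. \<Theta> $ p $ q) = 0" for p
      using T(2) by (simp add: matrix_vector_mult_def ones_def vec_eq_iff)
    have row: "\<Theta> $ i $ k = \<Theta> $ j $ k" if "k \<noteq> i" "k \<noteq> j" for k
      using D that by (simp add: D_eq_0_iff)
    have "\<Theta> $ i $ i = \<Theta> $ j $ j"
    proof (cases "i = j")
      case False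
      have split: "(\<Sum>q\<in>UNIV. f q) = f i + f j + (\<Sum>q\<in>UNIV - {i, j}. f q)" for f :: "'d \<Rightarrow> real"
        using False by (subst sum.subset_diff[of "{i, j}"]) auto
      \<comment> \<open>Both full row sums are zero and both contain the same off-diagonal entry at
        \<open>(i, j)\<close>; once the remaining columns agree, only the diagonal entries are left
        to compare.\<close>
      have "(\<Sum>q\<in>UNIV - {i, j}. \<Theta> $ i $ q) = (\<Sum>q\<in>UNIV - {i, j}. \<Theta> $ j $ q)"
        using row by (intro sum.cong) auto
      thus ?thesis
        using Tsum[of i] Tsum[of j] Tsym[of i j] by (simp add: split)
    qed simp
    hence "swap_matrix i j ** \<Theta> ** swap_matrix i j = \<Theta>"
      using T(1) D by (intro swap_invariantI)
    \<comment> \<open>The Moore-Penrose relation is symmetric, so \<open>A\<close> in turn is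
      determined by \<Theta>.\<close>
    hence inv: "swap_matrix i j ** A ** swap_matrix i j = A"
      using mp moore_penrose_inverse_swap moore_penrose_inverse_sym by blast
    \<comment> \<open>Equal diagonal entries of \<open>A\<close>; the row means then cancel when
      rows \<open>i\<close> and \<open>j\<close> of \<open>A\<close> are compared.\<close>
    have "r i = r j"
      using swap_invariantD(2)[OF inv] by (simp add: A G(2))
    thus "D \<Gamma> i j = 0"
      using swap_invariantD(1)[OF inv] by (auto simp: D_eq_0_iff A)
  qed
qed

section \<open>Stability of the row distances and the bound on the weights\<close>

lemma abs_entry_le_infnorm:
  fixes M :: "'d::finite rmat"
  shows "\<bar>M $ i $ j\<bar> \<le> infnorm M"
proof -
  have "axis i (axis j 1) \<in> (Basis :: 'd rmat set)"
    by (simp add: axis_in_Basis_iff)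
  from Basis_le_infnorm[OF this, of M] show ?thesis
    by (simp add: inner_axis)
qed

text \<open>Each of the \<open>d - 2\<close> row differences moves by at most
  \<open>2 * \<delta>\<close>. Bounding the Euclidean norm by the sum of absolute values gives the
  factor \<open>d - 2\<close> instead of its square root.\<close>

lemma D_perturbation:
  fixes G \<Gamma> :: "'d::finite rmat"
  assumes "infnorm (G - \<Gamma>) \<le> \<delta>" "i \<noteq> j"
  shows "\<bar>D G i j - D \<Gamma> i j\<bar> \<le> 2 * (real CARD('d) - 2) * \<delta>"
proof -
  define A where "A = UNIV - {i, j}"
  define e where "e M k = M $ i $ k - M $ j $ k" for M :: "'d rmat" and k
  have D: "D M i j = L2_set (e M) A" for M
    by (simp add: D_def L2_set_def e_def A_def)
  have diff: "L2_set (\<lambda>k. e M k - e N k) A \<le> 2 * (real CARD('d) - 2) * \<delta>"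
    if "infnorm (M - N) \<le> \<delta>" for M N
  proof -
    have "\<bar>M $ p $ k - N $ p $ k\<bar> \<le> \<delta>" for p k
      using abs_entry_le_infnorm[of "M - N" p k] that by simp
    hence "\<bar>e M k - e N k\<bar> \<le> 2 * \<delta>" for k
      using that by (smt (verit) e_def)
    hence "(\<Sum>k\<in>A. \<bar>e M k - e N k\<bar>) \<le> real (card A) * (2 * \<delta>)"
      by (intro sum_bounded_above) auto
    moreover have "real (card A) = real CARD('d) - 2"
    proof -
      have "card {i, j} = 2" using assms(2) by simp
      moreover have "card {i, j} \<le> CARD('d)" by (intro card_mono) auto
      ultimately show ?thesis by (simp add: A_def card_Diff_subset of_nat_diff)
    qed
    ultimately show ?thesis
      using L2_set_le_sum_abs[of "\<lambda>k. e M k - e N k" A] by (simp add: algebra_simps)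
  qed
  have "L2_set (e M) A \<le> L2_set (e N) A + L2_set (\<lambda>k. e M k - e N k) A" for M N
    using L2_set_triangle_ineq[of "e N" "\<lambda>k. e M k - e N k" A] by simp
  from this[of G \<Gamma>] this[of \<Gamma> G] diff[of G \<Gamma>] diff[of \<Gamma> G] assms(1)
  show ?thesis
    unfolding D by (simp add: infnorm_sub)
qed

lemma same_cluster_refl:
  assumes "is_clustering Cl"
  shows "same_cluster Cl i i"
  using assms by (fastforce simp: is_clustering_def partition_on_def same_cluster_def)

lemma a_rate_nonneg:
  assumes "\<zeta> > 0"
  shows "a_rate d \<mu> \<zeta> \<delta> \<ge> 0"
  using assms by (simp add: a_rate_def le_max_iff_disj)

text \<open>The two terms of \<open>a_rate\<close> belong to the two kinds of pairs: within a
  cluster \<open>D \<Gamma> i j = 0\<close>, so \<open>D G i j \<le> \<kappa> * \<delta>\<close>;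
  across clusters \<open>D G i j \<ge> \<mu> - \<kappa> * \<delta>\<close>, which the separation
  hypothesis keeps positive before squaring.\<close>

lemma weight_error_le_a_rate:
  fixes G \<Gamma> \<Theta> :: "'d::{finite,linorder} rmat" and Cl :: "'k::finite \<Rightarrow> 'd set"
  assumes G: "variogram \<Gamma>" "hr_precision_matrix \<Gamma> \<Theta>" "\<Theta> \<in> SP1"
    and Cl: "is_clustering Cl" "T_star \<Theta> = {(i, j). i < j \<and> same_cluster Cl i j}"
    and close: "infnorm (G - \<Gamma>) \<le> \<delta>" and sep: "mu_star \<Gamma> \<Theta> > ereal (2 * (real CARD('d) - 2) * \<delta>)"
    and "\<zeta> > 0"
  shows "weight_error Cl \<zeta> G \<le> a_rate CARD('d) (mu_star \<Gamma> \<Theta>) \<zeta> \<delta>"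
proof -
  define \<mu> where "\<mu> = mu_star \<Gamma> \<Theta>"
  define \<kappa> where "\<kappa> = 2 * (real CARD('d) - 2)"
  have T: "same_cluster Cl i j \<longleftrightarrow> D \<Gamma> i j = 0" if "i < j" for i j
    using that Cl(2) hr_precision_D_eq_0_iff[OF G, of i j] by (auto simp: T_star_def set_eq_iff)
  have sc: "same_cluster Cl i j \<longleftrightarrow> same_cluster Cl j i" for i j
    by (auto simp: same_cluster_def)
  have a: "a_rate CARD('d) \<mu> \<zeta> \<delta> \<ge> 1 - exp (- \<zeta> * (\<kappa> * \<delta>)\<^sup>2)"
  proof -
    have "- \<zeta> * (\<kappa> * \<delta>)\<^sup>2 = - 4 * (real CARD('d) - 2)\<^sup>2 * \<zeta> * \<delta>\<^sup>2"
      unfolding \<kappa>_def power_mult_distrib by simp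
    thus ?thesis unfolding a_rate_def by (metis max.cobounded1)
  qed
  \<comment> \<open>\<open>T_star\<close> and \<open>mu_star\<close> only see pairs with
    \<open>i < j\<close>; the other pairs follow by symmetry, and on the diagonal both weights are
    1.\<close>
  have err_lt: "\<bar>w_hat \<zeta> G i j - w_star Cl i j\<bar> \<le> a_rate CARD('d) \<mu> \<zeta> \<delta>" if ij: "i < j" for i j
  proof (cases "same_cluster Cl i j")
    case True
    have "D G i j \<le> \<kappa> * \<delta>"
      using D_perturbation[OF close less_imp_neq[OF ij]] T[OF ij] True unfolding \<kappa>_def by auto
    hence "\<zeta> * (D G i j)\<^sup>2 \<le> \<zeta> * (\<kappa> * \<delta>)\<^sup>2"
      using \<open>\<zeta> > 0\<close> by (intro mult_left_mono power_mono) (auto simp: D_nonneg)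
    hence "1 - w_hat \<zeta> G i j \<le> 1 - exp (- \<zeta> * (\<kappa> * \<delta>)\<^sup>2)"
      by (simp add: w_hat_def)
    moreover have "w_hat \<zeta> G i j \<le> 1"
      using \<open>\<zeta> > 0\<close> by (simp add: w_hat_def)
    ultimately show ?thesis
      using a True by (simp add: w_star_def)
  next
    case False
    have "\<mu> \<le> ereal (D \<Gamma> i j)"
      unfolding \<mu>_def mu_star_def using ij False Cl(2)
      by (intro INF_lower2[of "(i, j)"]) auto
    moreover have "\<mu> > ereal (\<kappa> * \<delta>)"
      using sep by (simp add: \<mu>_def \<kappa>_def)
    \<comment> \<open>The pair at hand lies in different clusters, so \<mu> is finite.\<close>
    ultimately obtain m where m: "\<mu> = ereal m" "m \<le> D \<Gamma> i j" "m > \<kappa> * \<delta>"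
      by (cases \<mu>) auto
    have "m - \<kappa> * \<delta> \<le> D G i j"
      using D_perturbation[OF close less_imp_neq[OF ij]] m(2) unfolding \<kappa>_def by linarith
    hence "\<zeta> * (m - \<kappa> * \<delta>)\<^sup>2 \<le> \<zeta> * (D G i j)\<^sup>2"
      using \<open>\<zeta> > 0\<close> m by (intro mult_left_mono power_mono) auto
    thus ?thesis
      using False m(1) by (simp add: w_star_def w_hat_def a_rate_def \<kappa>_def le_max_iff_disj)
  qed
  have err: "\<bar>w_hat \<zeta> G i j - w_star Cl i j\<bar> \<le> a_rate CARD('d) \<mu> \<zeta> \<delta>" for i j
  proof (cases i j rule: linorder_cases)
    case equal
    thus ?thesis
      using same_cluster_refl[OF Cl(1)] a_rate_nonneg[OF \<open>\<zeta> > 0\<close>] by (simp add: w_hat_def w_star_def D_refl)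
  next
    case greater
    with err_lt[of j i] show ?thesis
      by (simp add: w_hat_def w_star_def sc[of i] D_sym[of G i])
  qed (use err_lt in blast)
  show ?thesis
    unfolding weight_error_def \<mu>_def[symmetric] using err by (subst Max_le_iff) auto
qed

text \<open>A finite non-empty minimum is attained, at a pair where \<open>D \<Theta>\<close> and
  hence \<open>D \<Gamma>\<close> is non-zero. A non-zero row distance requires a third index,
  whence \<open>CARD('d) \<ge> 3\<close>; this makes \<kappa> positive when the rate is
  rescaled.\<close>

lemma mu_star_pos:
  fixes \<Gamma> \<Theta> :: "'d::{finite,linorder} rmat"
  assumes "variogram \<Gamma>" "hr_precision_matrix \<Gamma> \<Theta>" "\<Theta> \<in> SP1"
  obtains "mu_star \<Gamma> \<Theta> = \<infinity>"
  | m where "mu_star \<Gamma> \<Theta> = ereal m" "m > 0" "CARD('d) \<ge> 3"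
proof (cases "{(i, j). i < j \<and> (i, j) \<notin> T_star \<Theta>} = {}")
  case True
  thus ?thesis using that(1) unfolding mu_star_def by (simp only: INF_empty) (simp add: top_ereal_def)
next
  case False
  let ?N = "{(i, j). i < j \<and> (i, j) \<notin> T_star \<Theta>}"
  have "mu_star \<Gamma> \<Theta> = Min ((\<lambda>(i, j). ereal (D \<Gamma> i j)) ` ?N)"
    unfolding mu_star_def using False by (intro cInf_eq_Min) auto
  also have "\<dots> \<in> (\<lambda>(i, j). ereal (D \<Gamma> i j)) ` ?N"
    using False by (intro Min_in) auto
  finally obtain i j where ij: "i < j" "(i, j) \<notin> T_star \<Theta>" "mu_star \<Gamma> \<Theta> = ereal (D \<Gamma> i j)"
    by auto
  have D: "D \<Gamma> i j \<noteq> 0"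
    using ij hr_precision_D_eq_0_iff[OF assms] by (auto simp: T_star_def)
  then obtain l where "l \<noteq> i" "l \<noteq> j" by (auto simp: D_eq_0_iff)
  hence "card {i, j, l} = 3" using ij by auto
  moreover have "card {i, j, l} \<le> CARD('d)" by (intro card_mono) auto
  ultimately show ?thesis
    using that(2)[of "D \<Gamma> i j"] ij D D_nonneg[of \<Gamma> i j] by linarith
qed

section \<open>The rate: its limit and its behaviour under rescaling of the radius\<close>

text \<open>The point \<open>- x\<close> is the convex combination of \<open>0\<close> and
  \<open>- L * x\<close> with weight \<open>1 / L\<close> on the latter, so convexity of
  \<open>exp\<close> applies.\<close>

lemma concave_exp_scale:
  fixes x L :: real
  assumes "L \<ge> 1" "x \<ge> 0"
  shows "1 - exp (- L * x) \<le> L * (1 - exp (- x))"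
proof -
  have "exp ((1 - 1 / L) *\<^sub>R 0 + (1 / L) *\<^sub>R (- L * x)) \<le> (1 - 1 / L) * exp 0 + 1 / L * exp (- L * x)"
    using assms by (intro convex_onD[OF exp_convex]) auto
  hence "exp (- x) \<le> 1 - 1 / L + 1 / L * exp (- L * x)"
    using assms by simp
  hence "L * exp (- x) \<le> L * (1 - 1 / L + 1 / L * exp (- L * x))"
    using assms by (intro mult_left_mono) auto
  thus ?thesis using assms by (simp add: distrib_left right_diff_distrib)
qed

lemma zeta_delta_sq_tendsto_0:
  fixes \<zeta> \<delta> :: "nat \<Rightarrow> real"
  assumes "\<And>n. \<zeta> n > 0" "\<zeta> \<in> o(\<lambda>n. 1 / (\<delta> n)\<^sup>2)"
  shows "(\<lambda>n. \<zeta> n * (\<delta> n)\<^sup>2) \<longlonglongrightarrow> 0"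
proof (rule tendstoI)
  fix e :: real assume "e > 0"
  hence "\<forall>\<^sub>F n in sequentially. norm (\<zeta> n) \<le> (e / 2) * norm (1 / (\<delta> n)\<^sup>2)"
    using assms(2) by (intro landau_o.smallD) auto
  thus "\<forall>\<^sub>F n in sequentially. dist (\<zeta> n * (\<delta> n)\<^sup>2) 0 < e"
  proof eventually_elim
    case (elim n)
    \<comment> \<open>\<open>\<delta> n = 0\<close> would make the bound \<open>1 / 0 = 0\<close>, contradicting \<open>\<zeta> n > 0\<close>.\<close>
    have "\<delta> n \<noteq> 0" using elim assms(1)[of n] by auto
    hence "\<zeta> n * (\<delta> n)\<^sup>2 \<le> e / 2"
      using elim assms(1)[of n] by (simp add: field_simps)
    moreover have "\<zeta> n * (\<delta> n)\<^sup>2 \<ge> 0" using assms(1)[of n] by simp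
    ultimately show ?case using \<open>e > 0\<close> by simp
  qed
qed

text \<open>The square of \<open>\<delta> n\<close> is the product of two null sequences,
  \<open>\<zeta> n * (\<delta> n)\<^sup>2\<close> and \<open>inverse (\<zeta> n)\<close>.\<close>

lemma delta_tendsto_0:
  fixes \<zeta> \<delta> :: "nat \<Rightarrow> real"
  assumes "(\<lambda>n. \<zeta> n * (\<delta> n)\<^sup>2) \<longlonglongrightarrow> 0" "filterlim \<zeta> at_top sequentially"
  shows "\<delta> \<longlonglongrightarrow> 0"
proof -
  have "(\<lambda>n. \<zeta> n * (\<delta> n)\<^sup>2 * inverse (\<zeta> n)) \<longlonglongrightarrow> 0 * 0"
    using assms by (intro tendsto_mult tendsto_inverse_0_at_top)
  moreover have "\<forall>\<^sub>F n in sequentially. \<zeta> n * (\<delta> n)\<^sup>2 * inverse (\<zeta> n) = (\<delta> n)\<^sup>2"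
    using assms(2)[unfolded filterlim_at_top_dense, rule_format, of 0] by eventually_elim simp
  ultimately have "(\<lambda>n. (\<delta> n)\<^sup>2) \<longlonglongrightarrow> 0"
    by (simp add: tendsto_cong)
  hence "(\<lambda>n. sqrt ((\<delta> n)\<^sup>2)) \<longlonglongrightarrow> sqrt 0" by (rule tendsto_real_sqrt)
  thus ?thesis by (simp add: tendsto_rabs_zero_iff)
qed

lemma a_rate_tendsto_0:
  fixes \<zeta> \<delta> :: "nat \<Rightarrow> real"
  assumes \<zeta>\<delta>: "(\<lambda>n. \<zeta> n * (\<delta> n)\<^sup>2) \<longlonglongrightarrow> 0" and \<zeta>: "filterlim \<zeta> at_top sequentially"
    and \<mu>: "\<mu> = \<infinity> \<or> (\<exists>m>0. \<mu> = ereal m)"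
  shows "(\<lambda>n. a_rate d \<mu> (\<zeta> n) (\<delta> n)) \<longlonglongrightarrow> 0"
proof -
  have "(\<lambda>n. 1 - exp (- 4 * (real d - 2)\<^sup>2 * (\<zeta> n * (\<delta> n)\<^sup>2))) \<longlonglongrightarrow> 1 - exp (- 4 * (real d - 2)\<^sup>2 * 0)"
    by (intro tendsto_intros \<zeta>\<delta>)
  hence 1: "(\<lambda>n. 1 - exp (- 4 * (real d - 2)\<^sup>2 * \<zeta> n * (\<delta> n)\<^sup>2)) \<longlonglongrightarrow> 0"
    by (simp add: mult.assoc)
  show ?thesis
  proof (cases "\<mu> = \<infinity>")
    case True
    with tendsto_max[OF 1 tendsto_const[of 0]] show ?thesis by (simp add: a_rate_def)
  next
    case False
    then obtain m where m: "m > 0" "\<mu> = ereal m" using \<mu> by auto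
    \<comment> \<open>The limit \<open>m\<^sup>2\<close> is positive, so the product with \<zeta>
      diverges and the exponential vanishes.\<close>
    have "(\<lambda>n. (m - 2 * (real d - 2) * \<delta> n)\<^sup>2) \<longlonglongrightarrow> (m - 2 * (real d - 2) * 0)\<^sup>2"
      by (intro tendsto_intros delta_tendsto_0[OF \<zeta>\<delta> \<zeta>])
    hence "filterlim (\<lambda>n. (m - 2 * (real d - 2) * \<delta> n)\<^sup>2 * \<zeta> n) at_top sequentially"
      by (rule filterlim_tendsto_pos_mult_at_top) (use m \<zeta> in auto)
    hence "filterlim (\<lambda>n. - (\<zeta> n * (m - 2 * (real d - 2) * \<delta> n)\<^sup>2)) at_bot sequentially"
      by (subst filterlim_uminus_at_bot) (simp add: mult.commute)
    hence "(\<lambda>n. exp (- (\<zeta> n * (m - 2 * (real d - 2) * \<delta> n)\<^sup>2))) \<longlonglongrightarrow> 0"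
      by (rule filterlim_compose[OF exp_at_bot])
    from tendsto_max[OF 1 this] show ?thesis by (simp add: a_rate_def m)
  qed
qed

text \<open>For the separation term: if \<open>\<zeta>\<delta> \<le> 1\<close>, rescaling \<open>\<delta>\<close> changes the exponent
  \<open>\<zeta>(\<mu> - \<kappa>\<delta>)\<^sup>2\<close> by a bounded amount; if \<open>\<zeta>\<delta> > 1\<close>, the term is of order
  \<open>exp (- \<zeta>\<mu>\<^sup>2/4)\<close>, which is negligible against \<open>\<zeta>\<delta>\<^sup>2 > 1/\<zeta>\<close>.\<close>

lemma a_rate_scale:
  fixes \<zeta> \<delta> :: "nat \<Rightarrow> real"
  assumes \<zeta>_pos: "\<And>n. \<zeta> n > 0"
    and \<zeta>\<delta>: "(\<lambda>n. \<zeta> n * (\<delta> n)\<^sup>2) \<longlonglongrightarrow> 0" and \<zeta>: "filterlim \<zeta> at_top sequentially"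
    and \<delta>_nonneg: "\<forall>\<^sub>F n in sequentially. \<delta> n \<ge> 0"
    and \<mu>: "\<mu> = \<infinity> \<or> (\<exists>m>0. \<mu> = ereal m) \<and> d \<ge> 3" and "L \<ge> 1"
  shows "\<exists>B>0. \<forall>\<^sub>F n in sequentially. a_rate d \<mu> (\<zeta> n) (L * \<delta> n) \<le> B * a_rate d \<mu> (\<zeta> n) (\<delta> n)"
proof -
  define \<kappa> where "\<kappa> = 2 * (real d - 2)"
  have L2: "L\<^sup>2 \<ge> 1" using \<open>L \<ge> 1\<close> by simp
  have \<kappa>_eq: "- 4 * (real d - 2)\<^sup>2 * z * x\<^sup>2 = - (\<kappa>\<^sup>2 * z * x\<^sup>2)" for z x
    unfolding \<kappa>_def power_mult_distrib by simp
  have first: "1 - exp (- (\<kappa>\<^sup>2 * \<zeta> n * (L * \<delta> n)\<^sup>2)) \<le> L\<^sup>2 * (1 - exp (- (\<kappa>\<^sup>2 * \<zeta> n * (\<delta> n)\<^sup>2)))" for n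
    using concave_exp_scale[OF L2, of "\<kappa>\<^sup>2 * \<zeta> n * (\<delta> n)\<^sup>2"] \<zeta>_pos[of n]
    by (simp add: power_mult_distrib algebra_simps)
  show ?thesis
  proof (cases "\<mu> = \<infinity>")
    case True
    have "a_rate d \<mu> (\<zeta> n) (L * \<delta> n) \<le> L\<^sup>2 * a_rate d \<mu> (\<zeta> n) (\<delta> n)" for n
    proof -
      have "1 - exp (- (\<kappa>\<^sup>2 * \<zeta> n * x\<^sup>2)) \<ge> 0" for x
        using \<zeta>_pos[of n] by simp
      thus ?thesis
        using first[of n] unfolding a_rate_def \<kappa>_eq by (simp add: True max_absorb1 del: diff_ge_0_iff_ge)
    qed
    thus ?thesis using L2 by (intro exI[of _ "L\<^sup>2"]) auto
  next
    case False
    then obtain m where m: "m > 0" "\<mu> = ereal m" and "d \<ge> 3" using \<mu> by auto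
    hence "\<kappa> > 0" by (simp add: \<kappa>_def)
    \<comment> \<open>\<open>L\<^sup>2\<close> serves the first term of the rate, by concavity; the
      exponential serves the separation term when \<open>\<zeta> * \<delta> \<le> 1\<close>. In the
      remaining case \<open>B \<ge> 1\<close> is enough.\<close>
    define B where "B = max (L\<^sup>2) (exp (2 * m * \<kappa> * L))"
    have B: "B \<ge> 1" "B \<ge> L\<^sup>2" "B \<ge> exp (2 * m * \<kappa> * L)"
      using L2 by (auto simp: B_def)
    have a_eq: "a_rate d \<mu> z x = max (1 - exp (- (\<kappa>\<^sup>2 * z * x\<^sup>2))) (exp (- (z * (m - \<kappa> * x)\<^sup>2)))" for z x
      unfolding a_rate_def \<kappa>_eq m by (simp add: \<kappa>_def)
    have lim1: "(\<lambda>n. \<kappa> * L * \<delta> n) \<longlonglongrightarrow> \<kappa> * L * 0"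
      by (intro tendsto_intros delta_tendsto_0[OF \<zeta>\<delta> \<zeta>])
    have lim2: "(\<lambda>n. \<kappa>\<^sup>2 * (\<zeta> n * (\<delta> n)\<^sup>2)) \<longlonglongrightarrow> \<kappa>\<^sup>2 * 0"
      by (intro tendsto_intros \<zeta>\<delta>)
    have ev: "\<forall>\<^sub>F n in sequentially. \<kappa> * L * \<delta> n < m / 2"
              "\<forall>\<^sub>F n in sequentially. \<kappa>\<^sup>2 * (\<zeta> n * (\<delta> n)\<^sup>2) < 1"
      by (rule order_tendstoD(2)[OF lim1], use m in simp) (rule order_tendstoD(2)[OF lim2], simp)
    \<comment> \<open>Exponential decay beats \<open>1 / z\<close>. The threshold
      \<open>\<kappa>\<^sup>2 / 2\<close> used next matches the lower bound \<open>y / 2\<close> for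
      \<open>1 - exp (- y)\<close> at \<open>y = \<kappa>\<^sup>2 * z * x\<^sup>2\<close>.\<close>
    have "((\<lambda>z. z * exp (- (z * (m / 2)\<^sup>2))) \<longlongrightarrow> 0) at_top"
      using m(1) by real_asymp
    from filterlim_compose[OF this \<zeta>]
    have "\<forall>\<^sub>F n in sequentially. \<zeta> n * exp (- (\<zeta> n * (m / 2)\<^sup>2)) < \<kappa>\<^sup>2 / 2"
      by (rule order_tendstoD(2)) (use \<open>\<kappa> > 0\<close> in simp)
    with ev \<delta>_nonneg
    have "\<forall>\<^sub>F n in sequentially. a_rate d \<mu> (\<zeta> n) (L * \<delta> n) \<le> B * a_rate d \<mu> (\<zeta> n) (\<delta> n)"
    proof eventually_elim
      case (elim n)
      define z x where "z = \<zeta> n" and "x = \<delta> n"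
      note elim = elim[folded z_def x_def]
      have "z > 0" using \<zeta>_pos by (simp add: z_def)
      define A where "A = a_rate d \<mu> z x"
      have A: "A \<ge> 1 - exp (- (\<kappa>\<^sup>2 * z * x\<^sup>2))" "A \<ge> exp (- (z * (m - \<kappa> * x)\<^sup>2))"
        by (auto simp: A_def a_eq)
      have "A \<ge> 0" using a_rate_nonneg[OF \<open>z > 0\<close>] by (simp add: A_def)
      have "1 - exp (- (\<kappa>\<^sup>2 * z * (L * x)\<^sup>2)) \<le> L\<^sup>2 * A"
        using first[of n] A(1) L2 unfolding z_def x_def by (smt (verit) mult_left_mono)
      also have "\<dots> \<le> B * A"
        using B(2) \<open>A \<ge> 0\<close> by (rule mult_right_mono)
      finally have 1: "1 - exp (- (\<kappa>\<^sup>2 * z * (L * x)\<^sup>2)) \<le> B * A" .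
      have 2: "exp (- (z * (m - \<kappa> * (L * x))\<^sup>2)) \<le> B * A"
      proof (cases "z * x \<le> 1")
        case True
        have "(m - \<kappa> * x)\<^sup>2 - (m - \<kappa> * (L * x))\<^sup>2
            = 2 * m * \<kappa> * L * x - 2 * m * \<kappa> * x - (L\<^sup>2 - 1) * (\<kappa> * x)\<^sup>2"
          by (simp add: power2_eq_square algebra_simps)
        also have "\<dots> \<le> 2 * m * \<kappa> * L * x"
          using elim m \<open>\<kappa> > 0\<close> L2 by (smt (verit) mult_nonneg_nonneg zero_le_power2)
        finally have "z * ((m - \<kappa> * x)\<^sup>2 - (m - \<kappa> * (L * x))\<^sup>2) \<le> z * (2 * m * \<kappa> * L * x)"
          using \<open>z > 0\<close> by (intro mult_left_mono) auto
        also have "\<dots> = (z * x) * (2 * m * \<kappa> * L)" by simp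
        also have "\<dots> \<le> 1 * (2 * m * \<kappa> * L)"
          using True m \<open>\<kappa> > 0\<close> \<open>L \<ge> 1\<close> by (intro mult_right_mono) auto
        finally have "exp (- (z * (m - \<kappa> * (L * x))\<^sup>2))
            \<le> exp (2 * m * \<kappa> * L) * exp (- (z * (m - \<kappa> * x)\<^sup>2))"
          unfolding exp_add[symmetric] by (simp add: right_diff_distrib)
        also have "\<dots> \<le> B * A"
          using A(2) B by (intro mult_mono) auto
        finally show ?thesis .
      next
        case False
        have "(m / 2)\<^sup>2 \<le> (m - \<kappa> * (L * x))\<^sup>2"
          using elim m by (intro power_mono) (auto simp: mult.assoc)
        hence "exp (- (z * (m - \<kappa> * (L * x))\<^sup>2)) \<le> exp (- (z * (m / 2)\<^sup>2))"
          using \<open>z > 0\<close> by simp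
        also have "\<dots> \<le> \<kappa>\<^sup>2 / 2 / z"
          using elim \<open>z > 0\<close> by (simp add: field_simps)
        also have "\<dots> \<le> \<kappa>\<^sup>2 * z * x\<^sup>2 / 2"
        proof -
          have "1 \<le> (z * x)\<^sup>2" using False by simp
          hence "1 / z \<le> (z * x)\<^sup>2 / z" using \<open>z > 0\<close> by (intro divide_right_mono) auto
          also have "\<dots> = z * x\<^sup>2" using \<open>z > 0\<close> by (simp add: power2_eq_square)
          finally have "\<kappa>\<^sup>2 / 2 * (1 / z) \<le> \<kappa>\<^sup>2 / 2 * (z * x\<^sup>2)" by (intro mult_left_mono) auto
          thus ?thesis by simp
        qed
        also have "\<dots> \<le> 1 - exp (- (\<kappa>\<^sup>2 * z * x\<^sup>2))"
        proof -
          define y where "y = \<kappa>\<^sup>2 * z * x\<^sup>2"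
          have y: "0 \<le> y" "y \<le> 1" using elim \<open>z > 0\<close> by (auto simp: y_def mult.assoc)
          \<comment> \<open>On \<open>[0, 1]\<close> the linear bound
            \<open>y / 2 \<le> 1 - exp (- y)\<close> is reached through
            \<open>1 / (1 + y)\<close>.\<close>
          have "exp (- y) \<le> 1 / (1 + y)"
            using exp_ge_add_one_self[of y] y by (simp add: exp_minus field_simps)
          also have "\<dots> \<le> 1 - y / 2"
          proof -
            have "y * y \<le> y" using y by (simp add: mult_left_le)
            thus ?thesis using y by (simp add: field_simps)
          qed
          finally show ?thesis by (simp add: y_def)
        qed
        also have "\<dots> \<le> A" by (rule A(1))
        also have "\<dots> \<le> B * A" using B(1) \<open>A \<ge> 0\<close> by (simp add: mult_le_cancel_right1)
        finally show ?thesis .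
      qed
      show ?case
        using 1 2 unfolding z_def x_def A_def by (subst a_eq) simp
    qed
    thus ?thesis using B(1) by (intro exI[of _ B]) auto
  qed
qed

section \<open>The radius as a function of the level\<close>

lemma delta_nonneg:
  assumes "C > 0" "c > 0" "M * real d ^ 3 / \<epsilon> \<ge> 1"
  shows "delta C c M \<beta> d n k \<epsilon> \<ge> 0"
  using assms unfolding delta_def
  by (intro mult_nonneg_nonneg add_nonneg_nonneg divide_nonneg_nonneg) auto

text \<open>The level enters only through the root \<open>s\<close>. As
  \<open>s \<epsilon> \<ge> 0\<close>, multiplying the bracket by \<open>1 + s \<epsilon>'\<close>
  dominates both of its summands, and this factor is independent of \<open>n\<close> and
  \<open>k\<close>.\<close>

lemma delta_le_scale:
  assumes "C > 0" "c > 0" "M * real d ^ 3 / \<epsilon> \<ge> 1" "M * real d ^ 3 / \<epsilon>' \<ge> 1"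
  shows "delta C c M \<beta> d n k \<epsilon>' \<le> (1 + sqrt (1 / c * ln (M * real d ^ 3 / \<epsilon>'))) * delta C c M \<beta> d n k \<epsilon>"
proof -
  define s where "s \<epsilon> = sqrt (1 / c * ln (M * real d ^ 3 / \<epsilon>))" for \<epsilon>
  define t where "t = (real k / real n) powr \<beta> * (ln (real n / real k))\<^sup>2"
  have s: "s \<epsilon> \<ge> 0" "s \<epsilon>' \<ge> 0"
    using assms by (auto simp: s_def)
  have "t \<ge> 0" by (simp add: t_def)
  have "t \<le> (1 + s \<epsilon>') * t"
    using s \<open>t \<ge> 0\<close> by (simp add: algebra_simps)
  moreover have "(1 + s \<epsilon>') / sqrt (real k) \<le> (1 + s \<epsilon>') * (1 + s \<epsilon>) / sqrt (real k)"
    using s by (intro divide_right_mono) (auto simp: algebra_simps)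
  ultimately have "t + (1 + s \<epsilon>') / sqrt (real k) \<le> (1 + s \<epsilon>') * (t + (1 + s \<epsilon>) / sqrt (real k))"
    by (simp add: algebra_simps)
  hence "C * (t + (1 + s \<epsilon>') / sqrt (real k)) \<le> C * ((1 + s \<epsilon>') * (t + (1 + s \<epsilon>) / sqrt (real k)))"
    using assms(1) by (intro mult_left_mono) auto
  thus ?thesis
    by (simp add: delta_def s_def t_def mult.left_commute)
qed

section \<open>Measurability of the empirical variogram\<close>

lemma emp_cdf_measurable:
  assumes "\<And>t. Xs t \<in> borel_measurable P"
  shows "(\<lambda>\<omega>. emp_cdf n (\<lambda>t. Xs t \<omega>) i (Xs t \<omega> $ i)) \<in> borel_measurable P"
proof -
  have comp [measurable]: "(\<lambda>\<omega>. Xs t \<omega> $ i) \<in> borel_measurable P" for t i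
    unfolding cart_eq_inner_axis using assms by (intro borel_measurable_inner borel_measurable_const)
  have "real (card {s. s < n \<and> Xs s \<omega> $ i < Xs t \<omega> $ i})
      = (\<Sum>s<n. if Xs s \<omega> $ i < Xs t \<omega> $ i then 1 else 0)" for \<omega>
    by (subst sum.inter_filter[symmetric]) auto
  thus ?thesis
    unfolding emp_cdf_def by simp
qed

text \<open>Makes the deviation event measurable, so that its probability bounds that of every
  subset. The random index set \<open>exceedances\<close> is removed by summing over all
  \<open>t < n\<close> with indicators, which is \<open>S\<close>.\<close>

lemma emp_variogram_measurable:
  fixes Xs :: "nat \<Rightarrow> 'a \<Rightarrow> 'd::finite rvec"
  assumes "\<And>t. Xs t \<in> borel_measurable P"
  shows "(\<lambda>\<omega>. emp_variogram n k (\<lambda>t. Xs t \<omega>)) \<in> borel_measurable P"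
proof -
  note [measurable] = emp_cdf_measurable[OF assms]
  define E where "E m t \<omega> \<longleftrightarrow> emp_cdf n (\<lambda>t. Xs t \<omega>) m (Xs t \<omega> $ m) > 1 - real k / real n" for m t \<omega>
  have [measurable]: "Measurable.pred P (E m t)" for m t
    unfolding E_def by measurable
  define F where "F i j t \<omega> = log_excess n (\<lambda>t. Xs t \<omega>) i t - log_excess n (\<lambda>t. Xs t \<omega>) j t" for i j t \<omega>
  have [measurable]: "F i j t \<in> borel_measurable P" for i j t
    unfolding F_def log_excess_def by measurable
  define S where "S m v \<omega> = (\<Sum>t<n. if E m t \<omega> then v t \<omega> else 0)" for m and v :: "nat \<Rightarrow> 'a \<Rightarrow> real" and \<omega>
  have [measurable]: "S m v \<in> borel_measurable P" if "\<And>t. v t \<in> borel_measurable P" for m v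
    using that unfolding S_def by measurable
  have sum: "(\<Sum>t\<in>exceedances n k (\<lambda>t. Xs t \<omega>) m. v t \<omega>) = S m v \<omega>" for m v \<omega>
    unfolding S_def exceedances_def E_def by (subst sum.inter_filter[symmetric]) (auto intro: sum.cong)
  have card: "real (card (exceedances n k (\<lambda>t. Xs t \<omega>) m)) = S m (\<lambda>_ _. 1) \<omega>" for m \<omega>
    unfolding sum[symmetric] by simp
  have sq: "(\<Sum>t\<in>exceedances n k (\<lambda>t. Xs t \<omega>) m. (F i j t \<omega> - S m (F i j) \<omega> / S m (\<lambda>_ _. 1) \<omega>)\<^sup>2)
      = S m (\<lambda>t \<omega>. (F i j t \<omega> - S m (F i j) \<omega> / S m (\<lambda>_ _. 1) \<omega>)\<^sup>2) \<omega>" for i j m \<omega>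
    by (rule sum)
  have entry: "emp_variogram n k (\<lambda>t. Xs t \<omega>) $ i $ j = 1 / real CARD('d) *
      (\<Sum>m\<in>UNIV. S m (\<lambda>t \<omega>. (F i j t \<omega> - S m (F i j) \<omega> / S m (\<lambda>_ _. 1) \<omega>)\<^sup>2) \<omega> / (S m (\<lambda>_ _. 1) \<omega> - 1))" for i j \<omega>
    unfolding emp_variogram_def emp_variogram_m_def sample_variance_def F_def[symmetric] card
    by (simp add: sum sq)
  have ent [measurable]: "(\<lambda>\<omega>. emp_variogram n k (\<lambda>t. Xs t \<omega>) $ i $ j) \<in> borel_measurable P" for i j
    unfolding entry by measurable
  show ?thesis
  proof (subst borel_measurable_euclidean_space, rule ballI)
    fix b :: "'d rmat" assume "b \<in> Basis"
    then obtain i j where "b = axis i (axis j 1)"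
      by (auto simp: Basis_vec_def)
    thus "(\<lambda>\<omega>. emp_variogram n k (\<lambda>t. Xs t \<omega>) \<bullet> b) \<in> borel_measurable P"
      by (simp add: inner_axis ent)
  qed
qed

section \<open>Boundedness in probability\<close>

lemma weight_error_bigO_in_prob:
  fixes \<Gamma> \<Theta> :: "'d::{finite,linorder} rmat"
    and Cl :: "'k::finite \<Rightarrow> 'd set"
    and P :: "'a measure" and Xs :: "nat \<Rightarrow> 'a \<Rightarrow> 'd rvec"
    and k :: "nat \<Rightarrow> nat" and \<zeta> :: "nat \<Rightarrow> real" and C c M \<beta> \<epsilon> :: real
  defines "\<delta> \<equiv> \<lambda>n. delta C c M \<beta> CARD('d) n (k n) \<epsilon>"
  assumes G: "variogram \<Gamma>" "hr_precision_matrix \<Gamma> \<Theta>" "\<Theta> \<in> SP1"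
    and Cl: "is_clustering Cl" "T_star \<Theta> = {(i, j). i < j \<and> same_cluster Cl i j}"
    and P: "prob_space P" and iid: "iid_copies P X Xs"
    and const: "C > 0" "c > 0" "M > 0" "\<epsilon> > 0"
    and \<zeta>_pos: "\<And>n. \<zeta> n > 0" and \<zeta>_o: "\<zeta> \<in> o(\<lambda>n. 1 / (\<delta> n)\<^sup>2)" and \<zeta>: "filterlim \<zeta> at_top sequentially"
    and A: "assumption_A2 P X Q Y K \<beta>'" "assumption_A3 \<Gamma>" and "0 < \<alpha>"
    and k: "\<forall>\<^sub>F n in sequentially. real n powr \<alpha> \<le> real (k n) \<and> real (k n) \<le> real n / 2"
    and \<epsilon>: "\<epsilon> \<le> M * real CARD('d) ^ 3"
    and CB: "concentration_bound P X Xs Q Y \<Gamma> K \<beta>' \<alpha> \<beta> C c M"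
  shows "bigO_in_prob P (\<lambda>n \<omega>. weight_error Cl (\<zeta> n) (emp_variogram n (k n) (\<lambda>t. Xs t \<omega>)))
           (\<lambda>n. a_rate CARD('d) (mu_star \<Gamma> \<Theta>) (\<zeta> n) (\<delta> n))"
  unfolding bigO_in_prob_def
proof (intro allI impI)
  fix \<eta> :: real assume "\<eta> > 0"
  interpret prob_space P by fact
  define \<mu> where "\<mu> = mu_star \<Gamma> \<Theta>"
  define G where "G n \<omega> = emp_variogram n (k n) (\<lambda>t. Xs t \<omega>)" for n \<omega>
  \<comment> \<open>At most \<eta> to reach the required probability, and at most \<epsilon> to
    inherit the upper limit on admissible levels.\<close>
  define \<epsilon>' where "\<epsilon>' = min \<eta> \<epsilon>"
  have \<epsilon>': "\<epsilon>' > 0" "\<epsilon>' \<le> M * real CARD('d) ^ 3" "\<epsilon>' \<le> \<eta>"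
    using \<open>\<eta> > 0\<close> const \<epsilon> by (auto simp: \<epsilon>'_def)
  define L where "L = 1 + sqrt (1 / c * ln (M * real CARD('d) ^ 3 / \<epsilon>'))"
  have "L \<ge> 1" using \<epsilon>' const by (simp add: L_def)
  have \<delta>': "delta C c M \<beta> CARD('d) n (k n) \<epsilon>' \<le> L * \<delta> n" for n
    unfolding \<delta>_def L_def using \<epsilon>' \<epsilon> const by (intro delta_le_scale) auto
  have \<delta>_nonneg: "\<delta> n \<ge> 0" for n
    unfolding \<delta>_def using \<epsilon> const by (intro delta_nonneg) auto
  note \<zeta>\<delta> = zeta_delta_sq_tendsto_0[OF \<zeta>_pos \<zeta>_o]
  have \<mu>: "\<mu> = \<infinity> \<or> (\<exists>m>0. \<mu> = ereal m) \<and> CARD('d) \<ge> 3"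
    using mu_star_pos[OF assms(2-4)] unfolding \<mu>_def by metis
  obtain B where B: "B > 0" "\<forall>\<^sub>F n in sequentially.
      a_rate CARD('d) \<mu> (\<zeta> n) (L * \<delta> n) \<le> B * a_rate CARD('d) \<mu> (\<zeta> n) (\<delta> n)"
    using a_rate_scale[OF \<zeta>_pos \<zeta>\<delta> \<zeta> always_eventually[OF allI[OF \<delta>_nonneg]] \<mu> \<open>L \<ge> 1\<close>] by auto
  \<comment> \<open>The deterministic bound is used at the enlarged radius
    \<open>L * \<delta> n\<close>, which still tends to zero.\<close>
  have sep: "\<forall>\<^sub>F n in sequentially. \<mu> > ereal (2 * (real CARD('d) - 2) * (L * \<delta> n))"
    using \<mu>
  proof
    assume "(\<exists>m>0. \<mu> = ereal m) \<and> CARD('d) \<ge> 3"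
    then obtain m where m: "m > 0" "\<mu> = ereal m" by auto
    have "(\<lambda>n. 2 * (real CARD('d) - 2) * (L * \<delta> n)) \<longlonglongrightarrow> 2 * (real CARD('d) - 2) * (L * 0)"
      by (intro tendsto_intros delta_tendsto_0[OF \<zeta>\<delta> \<zeta>])
    from order_tendstoD(2)[OF this, of m] m show ?thesis by simp
  qed simp
  \<comment> \<open>The exponent diverges for \<open>\<alpha> > 0\<close>, so every fixed positive
    level eventually exceeds the lower limit in the concentration bound; \<open>k n\<close> only
    enters through \<open>real n powr \<alpha> \<le> real (k n)\<close>.\<close>
  have "((\<lambda>n. M * real CARD('d) ^ 3 * exp (- c * (real n powr \<alpha> / ln (real n) ^ 8))) \<longlonglongrightarrow> 0)"
    using const \<open>\<alpha> > 0\<close> by real_asymp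
  hence small: "\<forall>\<^sub>F n in sequentially.
      M * real CARD('d) ^ 3 * exp (- c * (real n powr \<alpha> / ln (real n) ^ 8)) < \<epsilon>'"
    using \<epsilon>' by (auto elim!: order_tendstoD)
  have "\<forall>\<^sub>F n in sequentially.
      \<P>(\<omega> in P. \<bar>weight_error Cl (\<zeta> n) (G n \<omega>)\<bar> > B * \<bar>a_rate CARD('d) \<mu> (\<zeta> n) (\<delta> n)\<bar>) \<le> \<eta>"
    using B(2) sep small k eventually_gt_at_top[of 0]
  proof eventually_elim
    case (elim n)
    let ?bad = "{\<omega> \<in> space P. infnorm (G n \<omega> - \<Gamma>) > delta C c M \<beta> CARD('d) n (k n) \<epsilon>'}"
    have "M * real CARD('d) ^ 3 * exp (- c * real (k n) / ln (real n) ^ 8)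
        \<le> M * real CARD('d) ^ 3 * exp (- c * (real n powr \<alpha> / ln (real n) ^ 8))"
    proof -
      have "c * (real n powr \<alpha> / ln (real n) ^ 8) \<le> c * (real (k n) / ln (real n) ^ 8)"
        using elim const by (intro mult_left_mono divide_right_mono) auto
      thus ?thesis using const by (intro mult_left_mono) auto
    qed
    hence "measure P ?bad \<le> \<epsilon>'"
      using CB A elim \<epsilon>' unfolding concentration_bound_def G_def by auto
    moreover have "?bad \<in> sets P"
    proof -
      have "Xs t \<in> borel_measurable P" for t
        using iid by (auto simp: iid_copies_def indep_vars_def)
      hence [measurable]: "G n \<in> borel_measurable P"
        unfolding G_def by (rule emp_variogram_measurable)
      have "infnorm \<in> borel_measurable (borel :: 'd rmat measure)"
        by (intro borel_measurable_continuous_onI continuous_at_imp_continuous_on ballI continuous_infnorm continuous_ident)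
      hence [measurable]: "(\<lambda>\<omega>. infnorm (G n \<omega> - \<Gamma>)) \<in> borel_measurable P"
        by (rule measurable_compose[rotated]) measurable
      show ?thesis by measurable
    qed
    \<comment> \<open>Off the deviation event the weight error is at most the rate at
      \<open>L * \<delta> n\<close>, hence at most \<open>B\<close> times the rate at
      \<open>\<delta> n\<close>.\<close>
    moreover have "{\<omega> \<in> space P. \<bar>weight_error Cl (\<zeta> n) (G n \<omega>)\<bar>
        > B * \<bar>a_rate CARD('d) \<mu> (\<zeta> n) (\<delta> n)\<bar>} \<subseteq> ?bad"
    proof safe
      fix \<omega>
      assume *: "\<bar>weight_error Cl (\<zeta> n) (G n \<omega>)\<bar> > B * \<bar>a_rate CARD('d) \<mu> (\<zeta> n) (\<delta> n)\<bar>"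
      show "infnorm (G n \<omega> - \<Gamma>) > delta C c M \<beta> CARD('d) n (k n) \<epsilon>'"
      proof (rule ccontr)
        assume "\<not> ?thesis"
        hence "infnorm (G n \<omega> - \<Gamma>) \<le> L * \<delta> n" using \<delta>'[of n] by simp
        hence "weight_error Cl (\<zeta> n) (G n \<omega>) \<le> a_rate CARD('d) \<mu> (\<zeta> n) (L * \<delta> n)"
          using elim \<zeta>_pos unfolding \<mu>_def by (intro weight_error_le_a_rate[OF assms(2-6)]) auto
        moreover have "weight_error Cl (\<zeta> n) (G n \<omega>) \<ge> 0"
          unfolding weight_error_def by (subst Max_ge_iff) (auto intro: exI)
        moreover have "a_rate CARD('d) \<mu> (\<zeta> n) (\<delta> n) \<ge> 0"
          using \<zeta>_pos by (rule a_rate_nonneg)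
        ultimately show False using * elim by linarith
      qed
    qed
    ultimately show ?case
      using finite_measure_mono[of _ ?bad] \<epsilon>'(3) by (meson order_trans)
  qed
  thus "\<exists>B>0. \<forall>\<^sub>F n in sequentially. \<P>(\<omega> in P.
      \<bar>weight_error Cl (\<zeta> n) (emp_variogram n (k n) (\<lambda>t. Xs t \<omega>))\<bar>
        > B * \<bar>a_rate CARD('d) (mu_star \<Gamma> \<Theta>) (\<zeta> n) (\<delta> n)\<bar>) \<le> \<eta>"
    using B(1) unfolding G_def \<mu>_def by auto
qed

theorem proposition4:
  fixes \<Gamma> \<Theta> :: "'d::{finite,linorder} rmat"
    and Cl :: "'k::finite \<Rightarrow> 'd set"
    and P :: "'a measure" and X :: "'a \<Rightarrow> 'd rvec" and Xs :: "nat \<Rightarrow> 'a \<Rightarrow> 'd rvec"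
    and Q :: "'b measure" and Y :: "'b \<Rightarrow> 'd rvec"
    and C c M \<beta> \<epsilon> :: real
    and k :: "nat \<Rightarrow> nat" and \<zeta> \<delta> a :: "nat \<Rightarrow> real"
    and Gh :: "nat \<Rightarrow> 'a \<Rightarrow> 'd rmat" and \<mu> :: ereal
  assumes "variogram \<Gamma>" and "hr_precision_matrix \<Gamma> \<Theta>" and "\<Theta> \<in> SP1"
    and "is_clustering Cl" and "block_structured Cl \<Theta>"
    and "T_star \<Theta> = {(i, j). i < j \<and> same_cluster Cl i j}"
    and "prob_space P" and "iid_copies P X Xs"
    and "prob_space Q" and "husler_reiss Q Y \<Gamma>"
    and "in_domain_of_attraction P X Q Y"
    and "C > 0" and "c > 0" and "M > 0" and "\<beta> > 0" and "\<epsilon> > 0"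
    and Gh_eq: "Gh = (\<lambda>n \<omega>. emp_variogram n (k n) (\<lambda>t. Xs t \<omega>))"
    and \<delta>_eq: "\<delta> = (\<lambda>n. delta C c M \<beta> CARD('d) n (k n) \<epsilon>)"
    and \<mu>_eq: "\<mu> = mu_star \<Gamma> \<Theta>"
    and a_eq: "a = (\<lambda>n. a_rate CARD('d) \<mu> (\<zeta> n) (\<delta> n))"
    and "\<And>n. \<zeta> n > 0" and "\<zeta> \<in> o(\<lambda>n. 1 / (\<delta> n)\<^sup>2)" and "filterlim \<zeta> at_top sequentially"
  shows "a \<longlonglongrightarrow> 0
    \<and> (\<forall>n. \<forall>\<omega>\<in>space P.
         infnorm (Gh n \<omega> - \<Gamma>) \<le> \<delta> n \<longrightarrow> \<mu> > ereal (2 * (real CARD('d) - 2) * \<delta> n) \<longrightarrow>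
         weight_error Cl (\<zeta> n) (Gh n \<omega>) \<le> a n)
    \<and> (\<forall>K \<beta>' \<alpha>.
         assumption_A2 P X Q Y K \<beta>' \<and> assumption_A3 \<Gamma>
         \<and> 0 < \<alpha> \<and> \<alpha> < 1 \<and> \<beta> < \<beta>'
         \<and> (\<forall>\<^sub>F n in sequentially. real n powr \<alpha> \<le> real (k n) \<and> real (k n) \<le> real n / 2)
         \<and> (\<forall>\<^sub>F n in sequentially.
              M * real CARD('d) ^ 3 * exp (- c * real (k n) / ln (real n) ^ 8) \<le> \<epsilon>)
         \<and> \<epsilon> \<le> M * real CARD('d) ^ 3
         \<and> concentration_bound P X Xs Q Y \<Gamma> K \<beta>' \<alpha> \<beta> C c M \<longrightarrow>
         bigO_in_prob P (\<lambda>n \<omega>. weight_error Cl (\<zeta> n) (Gh n \<omega>)) a)"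
proof (intro conjI allI impI ballI)
  \<comment> \<open>Positivity matters: for \<open>\<mu> = 0\<close> the second exponential in the
    rate would tend to 1.\<close>
  have "\<mu> = \<infinity> \<or> (\<exists>m>0. \<mu> = ereal m)"
    using mu_star_pos[OF assms(1-3)] unfolding \<mu>_eq by metis
  thus "a \<longlonglongrightarrow> 0"
    unfolding a_eq by (intro a_rate_tendsto_0 zeta_delta_sq_tendsto_0 assms)
next
  fix n \<omega>
  assume "infnorm (Gh n \<omega> - \<Gamma>) \<le> \<delta> n" "\<mu> > ereal (2 * (real CARD('d) - 2) * \<delta> n)"
  thus "weight_error Cl (\<zeta> n) (Gh n \<omega>) \<le> a n"
    unfolding a_eq \<mu>_eq by (intro weight_error_le_a_rate assms)
next
  fix K \<beta>' \<alpha>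
  assume A: "assumption_A2 P X Q Y K \<beta>' \<and> assumption_A3 \<Gamma>
         \<and> 0 < \<alpha> \<and> \<alpha> < 1 \<and> \<beta> < \<beta>'
         \<and> (\<forall>\<^sub>F n in sequentially. real n powr \<alpha> \<le> real (k n) \<and> real (k n) \<le> real n / 2)
         \<and> (\<forall>\<^sub>F n in sequentially.
              M * real CARD('d) ^ 3 * exp (- c * real (k n) / ln (real n) ^ 8) \<le> \<epsilon>)
         \<and> \<epsilon> \<le> M * real CARD('d) ^ 3
         \<and> concentration_bound P X Xs Q Y \<Gamma> K \<beta>' \<alpha> \<beta> C c M"
  show "bigO_in_prob P (\<lambda>n \<omega>. weight_error Cl (\<zeta> n) (Gh n \<omega>)) a"
    unfolding a_eq \<mu>_eq \<delta>_eq Gh_eq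
    by (rule weight_error_bigO_in_prob[where Q = Q and Y = Y and K = K and \<beta>' = \<beta>' and \<alpha> = \<alpha>,
        OF assms(1-4,6-8,12-14,16,21) assms(22)[unfolded \<delta>_eq] assms(23)])
      (use A in simp_all)
qed

end
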